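(* Let $\Phi:(0,1)^2\times(0,1)\longrightarrow\Omega$ be defined by $$\Phi(u,v,p)=\left(u,\;v,\;\left(\frac{(1-u^p)(1-v^p)}{\left(1-(uv)^p\right)^2}\right)^{1/p}\right).$$ Then $\Phi$ (is well defined, i.e. takes values in $\Omega$, and) is a $C^\infty$-diffeomorphism between $(0,1)^2\times(0,1)$ and $\Omega$, with inverse $$\Phi^{-1}(u,v,w)=\bigl(u,v,p_*(u,v,w)\bigr).$$ In particular, the stability threshold $p_*$ provides a global smooth coordinate on $\Omega$, in the sense that $(u,v,p_* )$ is a global $C^\infty$ coordinate system on $\Omega$.
   Context: For $(u,v,w)\in(0,1)^3$ and $p>0$, define $$h(u,v,w,p)=\ln(1-u^p)+\ln(1-v^p)-2\ln\bigl(1-(uv)^p\bigr)-p\ln w,$$ and let $$\Omega=\bigl\{(u,v,w)\in(0,1)^3: h(u,v,w,1)>0\bigr\},$$ which is an open subset of $(0,1)^3$. For each $(u,v,w)\in\Omega$, the equation $h(u,v,w,p)=0$ (in the unknown $p>0$) has a unique solution, denoted $p_*(u,v,w)$ and called the stability threshold, and it lies in $(0,1)$. *)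

theory Defs
  imports "HOL-Analysis.Analysis"
begin

text \<open>
  \<open>C\<^sup>k\<close> regularity on an open set \<open>S\<close>: \<open>f\<close> is differentiable at every point of \<open>S\<close> and each
  directional derivative \<open>x \<mapsto> Df(x) v\<close> is of class \<open>C\<^sup>k\<^sup>-\<^sup>1\<close>.  In finite dimension this
  says that all iterated partial derivatives up to order \<open>k\<close> exist and are continuous on \<open>S\<close>.
  The derivative is taken at \<open>x\<close>, not within \<open>S\<close>; for open \<open>S\<close> only the values of \<open>f\<close> on \<open>S\<close> matter.
\<close>

primrec Ck_on :: "nat \<Rightarrow> 'a::euclidean_space set \<Rightarrow> ('a \<Rightarrow> 'b::euclidean_space) \<Rightarrow> bool" where
  "Ck_on 0 S f \<longleftrightarrow> continuous_on S f"
| "Ck_on (Suc k) S f \<longleftrightarrow>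
     (\<forall>x\<in>S. f differentiable (at x)) \<and>
     (\<forall>v. Ck_on k S (\<lambda>x. frechet_derivative f (at x) v))"

definition smooth_on :: "'a::euclidean_space set \<Rightarrow> ('a \<Rightarrow> 'b::euclidean_space) \<Rightarrow> bool" where
  "smooth_on S f \<longleftrightarrow> (\<forall>k. Ck_on k S f)"

text \<open>The argument order follows \<^const>\<open>homeomorphism\<close>; \<open>g\<close> is the inverse of \<open>f\<close>.\<close>

definition smooth_diffeomorphism ::
  "'a::euclidean_space set \<Rightarrow> 'b::euclidean_space set \<Rightarrow> ('a \<Rightarrow> 'b) \<Rightarrow> ('b \<Rightarrow> 'a) \<Rightarrow> bool" where
  "smooth_diffeomorphism S T f g \<longleftrightarrow>
     open S \<and> open T \<and>
     f ` S = T \<and> g ` T = S \<and>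
     (\<forall>x\<in>S. g (f x) = x) \<and> (\<forall>y\<in>T. f (g y) = y) \<and>
     smooth_on S f \<and> smooth_on T g"

definition global_smooth_coordinates ::
  "'a::euclidean_space set \<Rightarrow> ('a \<Rightarrow> 'b::euclidean_space) \<Rightarrow> bool" where
  "global_smooth_coordinates U \<phi> \<longleftrightarrow> (\<exists>V \<psi>. smooth_diffeomorphism U V \<phi> \<psi>)"

definition h :: "real \<Rightarrow> real \<Rightarrow> real \<Rightarrow> real \<Rightarrow> real" where
  "h u v w p =
     ln (1 - u powr p) + ln (1 - v powr p) - 2 * ln (1 - (u * v) powr p) - p * ln w"

definition Omega :: "(real \<times> real \<times> real) set" where
  "Omega = {(u, v, w). u \<in> {0<..<1} \<and> v \<in> {0<..<1} \<and> w \<in> {0<..<1} \<and> h u v w 1 > 0}"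

text \<open>Only meaningful for \<open>(u, v, w)\<close> in \<^const>\<open>Omega\<close>, where the positive solution is unique.\<close>

definition p_star :: "real \<Rightarrow> real \<Rightarrow> real \<Rightarrow> real" where
  "p_star u v w = (THE p. p > 0 \<and> h u v w p = 0)"

definition Phi :: "real \<times> real \<times> real \<Rightarrow> real \<times> real \<times> real" where
  "Phi = (\<lambda>(u, v, p).
     (u, v, ((1 - u powr p) * (1 - v powr p) / (1 - (u * v) powr p)\<^sup>2) powr (1 / p)))"

end

theory Submission
  imports Defs
begin

text \<open>
  Write \<open>h u v w p = F(p) - p ln w\<close>, where \<open>F\<close> (below \<open>log_ratio u v\<close>) does not involve \<open>w\<close>.
  Everything rests on two facts about \<open>F\<close> on \<open>p > 0\<close>: it is negative, and its derivative is positive.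
  With \<open>x = - p ln u\<close> and \<open>y = - p ln v\<close> one finds
  \<open>p F'(p) = \<phi>(x) + \<phi>(y) - 2 \<phi>(x + y)\<close> for \<open>\<phi>(t) = t / (e\<^sup>t - 1)\<close>, and \<open>\<phi>\<close> is strictly
  decreasing (\<open>log_ratio_deriv_pos\<close>, \<open>log_ratio_neg\<close>).

  Since \<open>- p ln w\<close> increases with \<open>p\<close> as well, \<open>h u v w\<close> is strictly increasing in \<open>p\<close>, so it has at
  most one zero, and a zero \<open>p < 1\<close> forces \<open>h u v w 1 > 0\<close>; hence \<^const>\<open>Phi\<close> maps the cube into
  \<^const>\<open>Omega\<close> and \<^const>\<open>p_star\<close> recovers \<open>p\<close>.  Conversely, on \<^const>\<open>Omega\<close> the point
  \<open>p\<^sub>0 = F(1) / ln w\<close> lies in \<open>(0, 1)\<close> and \<open>h u v w p\<^sub>0 = F(p\<^sub>0) - F(1) < 0 < h u v w 1\<close>, so a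
  zero exists between \<open>p\<^sub>0\<close> and \<open>1\<close> (\<open>threshold_exists\<close>).

  On the cube the last component of \<^const>\<open>Phi\<close> is \<open>exp (F(p) / p)\<close>.  It is smooth, and its partial
  derivative in \<open>p\<close> has the sign of \<open>p F'(p) - F(p) > 0\<close>.  So the differential of \<^const>\<open>Phi\<close>, which
  is triangular, is invertible everywhere, with an inverse that depends smoothly on the point.  The
  smooth inverse function theorem in the form \<open>smooth_on_left_inverse\<close> then makes the inverse smooth.
\<close>

section \<open>Calculus of smooth maps\<close>

lemma Ck_on_cong:
  assumes "open S" "\<And>x. x \<in> S \<Longrightarrow> f x = g x" "Ck_on k S f"
  shows "Ck_on k S g"
  using assms(2,3)
proof (induction k arbitrary: f g)
  case 0
  then show ?case by (metis Ck_on.simps(1) continuous_on_cong)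
next
  case (Suc k)
  have der: "(g has_derivative frechet_derivative f (at x)) (at x)" if "x \<in> S" for x
    using Suc.prems that has_derivative_transform_within_open[OF _ assms(1) that]
    by (metis Ck_on.simps(2) frechet_derivative_works)
  have "Ck_on k S (\<lambda>x. frechet_derivative g (at x) v)" for v
  proof (rule Suc.IH)
    show "frechet_derivative f (at x) v = frechet_derivative g (at x) v" if "x \<in> S" for x
      using frechet_derivative_at[OF der[OF that]] by simp
    show "Ck_on k S (\<lambda>x. frechet_derivative f (at x) v)"
      using Suc.prems by simp
  qed
  with der show ?case by (auto simp: differentiable_def)
qed

text \<open>
  On an open set the derivative is determined, so \<open>C\<^sup>k\<close> regularity can be checked on any explicit
  formula for the derivative instead of \<^const>\<open>frechet_derivative\<close>.
\<close>

lemma Ck_on_SucI: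
  assumes "open S" "\<And>x. x \<in> S \<Longrightarrow> (f has_derivative f' x) (at x)"
    and "\<And>v. Ck_on k S (\<lambda>x. f' x v)"
  shows "Ck_on (Suc k) S f"
proof -
  have "Ck_on k S (\<lambda>x. frechet_derivative f (at x) v)" for v
    by (rule Ck_on_cong[OF assms(1) _ assms(3)[of v]])
       (metis assms(2) frechet_derivative_at)
  with assms(2) show ?thesis by (auto simp: differentiable_def)
qed

lemma Ck_on_Suc_has_derivative:
  assumes "Ck_on (Suc k) S f" "x \<in> S"
  shows "(f has_derivative frechet_derivative f (at x)) (at x)"
  using assms by (simp add: flip: frechet_derivative_works)

lemma Ck_on_SucD: "Ck_on (Suc k) S f \<Longrightarrow> Ck_on k S f"
proof (induction k arbitrary: f)
  case 0
  then show ?case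
    by (auto intro!: continuous_at_imp_continuous_on differentiable_imp_continuous_within)
next
  case (Suc k)
  then show ?case by (metis Ck_on.simps(2))
qed

lemma Ck_on_const: "open S \<Longrightarrow> Ck_on k S (\<lambda>x. c)"
proof (induction k arbitrary: c)
  case (Suc k)
  then show ?case by (intro Ck_on_SucI[where f' = "\<lambda>x v. 0"]) auto
qed auto

lemma Ck_on_linear:
  assumes "open S" "bounded_linear L"
  shows "Ck_on k S L"
proof (cases k)
  case 0
  then show ?thesis by (simp add: assms linear_continuous_on)
next
  case (Suc j)
  then show ?thesis
    using Ck_on_SucI[OF assms(1), of L "\<lambda>x. L" j] assms
    by (auto intro: bounded_linear_imp_has_derivative Ck_on_const)
qed

lemma Ck_on_add:
  assumes "open S" "Ck_on k S f" "Ck_on k S g"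
  shows "Ck_on k S (\<lambda>x. f x + g x)"
  using assms(2,3)
proof (induction k arbitrary: f g)
  case 0
  then show ?case by (auto intro: continuous_on_add)
next
  case (Suc k)
  show ?case
    by (rule Ck_on_SucI[OF assms(1)],
        rule has_derivative_add[OF Suc.prems[THEN Ck_on_Suc_has_derivative]])
       (use Suc in auto)
qed

lemma Ck_on_sum:
  assumes "open S" "finite I" "\<And>i. i \<in> I \<Longrightarrow> Ck_on k S (f i)"
  shows "Ck_on k S (\<lambda>x. \<Sum>i\<in>I. f i x)"
  using assms(2,3)
  by (induction rule: finite_induct) (auto intro: Ck_on_const Ck_on_add assms(1))

lemma Ck_on_bilinear:
  assumes "open S" "bounded_bilinear B" "Ck_on k S f" "Ck_on k S g"
  shows "Ck_on k S (\<lambda>x. B (f x) (g x))"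
  using assms(3,4)
proof (induction k arbitrary: f g)
  case 0
  then show ?case by (auto intro: bounded_bilinear.continuous_on[OF assms(2)])
next
  case (Suc k)
  show ?case
    by (rule Ck_on_SucI[OF assms(1)],
        rule bounded_bilinear.FDERIV[OF assms(2) Suc.prems[THEN Ck_on_Suc_has_derivative]])
       (use Suc Suc.prems[THEN Ck_on_SucD] in \<open>auto intro!: Ck_on_add assms(1) Suc.IH\<close>)
qed

text \<open>
  By the chain rule the derivative in direction \<open>v\<close> is \<open>Df(g x) (Dg(x) v)\<close>. Regularity of \<open>Df\<close> is
  known only in fixed directions, so \<open>Dg(x) v\<close> is expanded in the basis; the coefficients and the
  functions \<open>Df(g x) b\<close> are \<open>C\<^sup>k\<close>, the latter by induction on the order, with \<open>f\<close> generalized.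
\<close>

lemma Ck_on_compose:
  assumes "open S" "open T" "g ` S \<subseteq> T" "Ck_on k T f" "Ck_on k S g"
  shows "Ck_on k S (\<lambda>x. f (g x))"
  using assms(4,5)
proof (induction k arbitrary: f)
  case 0
  then show ?case
    using assms(3) by (auto intro: continuous_on_compose2)
next
  case (Suc k)
  let ?f' = "\<lambda>y. frechet_derivative f (at y)" and ?g' = "\<lambda>x. frechet_derivative g (at x)"
  have f': "(f has_derivative ?f' (g x)) (at (g x))" if "x \<in> S" for x
    using Suc.prems(1) assms(3) that by (intro Ck_on_Suc_has_derivative) auto
  have expand: "(\<Sum>b\<in>Basis. (w \<bullet> b) *\<^sub>R ?f' (g x) b) = ?f' (g x) w" if "x \<in> S" for x w
  proof -
    have "linear (?f' (g x))"
      using f'[OF that] has_derivative_linear by blast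
    then have "?f' (g x) (\<Sum>b\<in>Basis. (w \<bullet> b) *\<^sub>R b) = (\<Sum>b\<in>Basis. (w \<bullet> b) *\<^sub>R ?f' (g x) b)"
      by (simp add: linear_sum linear_cmul)
    then show ?thesis by (simp add: euclidean_representation)
  qed
  show ?case
  proof (rule Ck_on_SucI[OF assms(1)])
    show "((\<lambda>x. f (g x)) has_derivative (\<lambda>v. ?f' (g x) (?g' x v))) (at x)" if "x \<in> S" for x
      using has_derivative_compose[OF Ck_on_Suc_has_derivative[OF Suc.prems(2) that] f'[OF that]] .
    fix v
    have "Ck_on k S (\<lambda>x. \<Sum>b\<in>Basis. (?g' x v \<bullet> b) *\<^sub>R ?f' (g x) b)"
    proof (intro Ck_on_sum assms(1) Ck_on_bilinear[OF _ bounded_bilinear_scaleR]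
        Ck_on_bilinear[OF _ bounded_bilinear_inner] Ck_on_const Suc.IH)
      show "Ck_on k S g" using Suc.prems(2) by (rule Ck_on_SucD)
    qed (use Suc.prems in auto)
    then show "Ck_on k S (\<lambda>x. ?f' (g x) (?g' x v))"
      by (rule Ck_on_cong[OF assms(1), rotated]) (rule expand)
  qed
qed

text \<open>
  The derivatives of \<open>exp\<close> and \<open>inverse\<close> are polynomials in the function itself, so smoothness follows
  by induction on the order; \<open>ln\<close> inherits it from its derivative \<open>inverse\<close>.
\<close>

lemma Ck_on_exp: "Ck_on k UNIV (exp :: real \<Rightarrow> real)"
proof (induction k)
  case (Suc k)
  show ?case
    by (rule Ck_on_SucI[where f' = "\<lambda>x v. exp x * v"])
       (auto intro!: derivative_eq_intros Ck_on_bilinear[OF _ bounded_bilinear_mult] Suc Ck_on_const)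
qed (auto intro: continuous_intros)

lemma Ck_on_inverse: "Ck_on k (- {0}) (inverse :: real \<Rightarrow> real)"
proof (induction k)
  case (Suc k)
  show ?case
  proof (rule Ck_on_SucI)
    show "(inverse has_derivative (\<lambda>v. inverse x * (inverse x * (- v)))) (at x)"
      if "x \<in> - {0}" for x :: real
      using that by (auto intro!: derivative_eq_intros)
    show "Ck_on k (- {0}) (\<lambda>x. inverse x * (inverse x * (- v)))" for v :: real
      by (intro Ck_on_bilinear[OF _ bounded_bilinear_mult] Suc Ck_on_const) auto
  qed auto
qed (auto intro!: continuous_intros)

lemma Ck_on_ln: "Ck_on k {0<..} (ln :: real \<Rightarrow> real)"
proof (cases k)
  case (Suc j)
  have "Ck_on j {0<..} (inverse :: real \<Rightarrow> real)"
    by (rule Ck_on_compose[where T = "- {0}" and g = "\<lambda>x. x"])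
       (auto intro: Ck_on_inverse Ck_on_linear bounded_linear_ident)
  then have "Ck_on (Suc j) {0<..} (ln :: real \<Rightarrow> real)"
    by (intro Ck_on_SucI[where f' = "\<lambda>x v. inverse x * v"])
       (auto intro!: derivative_eq_intros Ck_on_bilinear[OF _ bounded_bilinear_mult] Ck_on_const)
  with Suc show ?thesis by simp
qed (auto intro!: continuous_intros)

named_theorems smooth_intros

lemma smooth_on_const [smooth_intros]: "open S \<Longrightarrow> smooth_on S (\<lambda>x. c)"
  by (simp add: smooth_on_def Ck_on_const)

lemma smooth_on_linear: "open S \<Longrightarrow> bounded_linear L \<Longrightarrow> smooth_on S L"
  by (simp add: smooth_on_def Ck_on_linear)

lemma smooth_on_compose:
  "smooth_on T f \<Longrightarrow> smooth_on S g \<Longrightarrow> open S \<Longrightarrow> open T \<Longrightarrow> g ` S \<subseteq> T \<Longrightarrow> smooth_on S (\<lambda>x. f (g x))"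
  by (simp add: smooth_on_def Ck_on_compose)

lemma smooth_on_add [smooth_intros]:
  "open S \<Longrightarrow> smooth_on S f \<Longrightarrow> smooth_on S g \<Longrightarrow> smooth_on S (\<lambda>x. f x + g x)"
  by (simp add: smooth_on_def Ck_on_add)

lemma smooth_on_mult [smooth_intros]:
  fixes f g :: "_ \<Rightarrow> real"
  shows "open S \<Longrightarrow> smooth_on S f \<Longrightarrow> smooth_on S g \<Longrightarrow> smooth_on S (\<lambda>x. f x * g x)"
  by (simp add: smooth_on_def Ck_on_bilinear[OF _ bounded_bilinear_mult])

lemma smooth_on_diff [smooth_intros]:
  fixes f g :: "_ \<Rightarrow> real"
  assumes "open S" "smooth_on S f" "smooth_on S g"
  shows "smooth_on S (\<lambda>x. f x - g x)"
  using smooth_on_add[OF assms(1,2) smooth_on_mult[OF assms(1) smooth_on_const[of S "- 1"] assms(3)]]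
    assms(1) by simp

lemma smooth_on_divide [smooth_intros]:
  fixes f g :: "_ \<Rightarrow> real"
  assumes "open S" "smooth_on S f" "smooth_on S g" "\<And>x. x \<in> S \<Longrightarrow> g x \<noteq> 0"
  shows "smooth_on S (\<lambda>x. f x / g x)"
proof -
  have "smooth_on S (\<lambda>x. inverse (g x))"
    by (rule smooth_on_compose[where T = "- {0}"])
       (use assms in \<open>auto simp: smooth_on_def Ck_on_inverse\<close>)
  with assms show ?thesis by (simp add: divide_inverse smooth_on_mult)
qed

lemma smooth_on_exp [smooth_intros]:
  fixes f :: "_ \<Rightarrow> real"
  shows "open S \<Longrightarrow> smooth_on S f \<Longrightarrow> smooth_on S (\<lambda>x. exp (f x))"
  by (rule smooth_on_compose[where T = UNIV]) (auto simp: smooth_on_def Ck_on_exp)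

lemma smooth_on_ln [smooth_intros]:
  fixes f :: "_ \<Rightarrow> real"
  shows "open S \<Longrightarrow> smooth_on S f \<Longrightarrow> (\<And>x. x \<in> S \<Longrightarrow> 0 < f x) \<Longrightarrow> smooth_on S (\<lambda>x. ln (f x))"
  by (rule smooth_on_compose[where T = "{0<..}"]) (auto simp: smooth_on_def Ck_on_ln)

lemma smooth_on_Pair [smooth_intros]:
  assumes "open S" "smooth_on S f" "smooth_on S g"
  shows "smooth_on S (\<lambda>x. (f x, g x))"
proof -
  have "smooth_on S (\<lambda>x. (f x, 0) + (0, g x))"
    by (intro smooth_on_add smooth_on_compose[OF smooth_on_linear[of UNIV "\<lambda>y. (y, 0)"] assms(2)]
        smooth_on_compose[OF smooth_on_linear[of UNIV "\<lambda>y. (0, y)"] assms(3)])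
       (auto intro: bounded_linear_Pair bounded_linear_ident bounded_linear_zero assms(1))
  then show ?thesis by simp
qed

lemma smooth_on_has_derivative:
  assumes "smooth_on S f" "x \<in> S"
  shows "(f has_derivative frechet_derivative f (at x)) (at x)"
  using assms Ck_on_Suc_has_derivative smooth_on_def by blast

lemma smooth_on_frechet_derivative:
  "smooth_on S f \<Longrightarrow> smooth_on S (\<lambda>x. frechet_derivative f (at x) v)"
  unfolding smooth_on_def by (metis Ck_on.simps(2))

lemma smooth_on_imp_continuous_on: "smooth_on S f \<Longrightarrow> continuous_on S f"
  unfolding smooth_on_def by (metis Ck_on.simps(1))

lemma smooth_on_cong:
  "smooth_on S f \<Longrightarrow> open S \<Longrightarrow> (\<And>x. x \<in> S \<Longrightarrow> f x = g x) \<Longrightarrow> smooth_on S g"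
  unfolding smooth_on_def by (metis Ck_on_cong)

text \<open>
  The inverse function theorem for smooth maps. Differentiability of \<open>g\<close> at \<open>f x\<close>, with derivative
  \<open>B x\<close>, comes from the \<open>C\<^sup>1\<close> theory, and smoothness is bootstrapped: \<open>Dg(y) v = B (g y) v\<close>, so if \<open>g\<close>
  is \<open>C\<^sup>k\<close> then \<open>Dg\<close> is \<open>C\<^sup>k\<close> by composition and \<open>g\<close> is \<open>C\<^sup>k\<^sup>+\<^sup>1\<close>. The hypothesis names the
  pointwise inverse \<open>B\<close> of the differential and its regularity, which avoids any discussion of the
  smoothness of matrix inversion; in applications \<open>B\<close> is explicit. Openness of the image is
  invariance of domain.
\<close>

lemma smooth_on_left_inverse:
  fixes f g :: "'a::euclidean_space \<Rightarrow> 'a"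
  assumes "open S" "smooth_on S f" "\<And>x. x \<in> S \<Longrightarrow> g (f x) = x"
    and right_inv: "\<And>x. x \<in> S \<Longrightarrow> frechet_derivative f (at x) \<circ> B x = id"
    and smooth_B: "\<And>v. smooth_on S (\<lambda>x. B x v)"
  shows "open (f ` S)" "smooth_on (f ` S) g"
proof -
  have cont: "continuous_on S f"
    using assms(2) by (rule smooth_on_imp_continuous_on)
  show open_image: "open (f ` S)"
    using invariance_of_domain[OF cont assms(1)] assms(3) by (metis inj_on_inverseI)
  have der: "(g has_derivative B (g y)) (at y)" if "y \<in> f ` S" for y
  proof -
    from that obtain x where x: "x \<in> S" "y = f x" by blast
    have "(g has_derivative B x) (at (f x))"
      by (rule has_derivative_inverse_strong[OF assms(1) x(1) cont _ _ right_inv])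
         (use assms(3) x in \<open>auto intro: smooth_on_has_derivative[OF assms(2)]\<close>)
    with x assms(3) show ?thesis by simp
  qed
  have "Ck_on k (f ` S) g" for k
  proof (induction k)
    case 0
    show ?case
      using has_derivative_continuous[OF der] by (simp add: continuous_at_imp_continuous_on)
  next
    case (Suc k)
    show ?case
    proof (rule Ck_on_SucI[OF open_image der])
      show "Ck_on k (f ` S) (\<lambda>y. B (g y) v)" for v
        using smooth_B[of v] assms(3)
        by (intro Ck_on_compose[OF open_image assms(1) _ _ Suc, of "\<lambda>x. B x v"])
           (auto simp: smooth_on_def)
    qed
  qed
  then show "smooth_on (f ` S) g" by (simp add: smooth_on_def)
qed

section \<open>Monotonicity in the exponent\<close>

text \<open>
  The numerator of the derivative is \<open>e\<^sup>x - 1 - x e\<^sup>x\<close>, which is negative because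
  \<open>1 - x < e\<^sup>-\<^sup>x\<close>.
\<close>

lemma inverse_exp_slope_decreasing:
  fixes s t :: real
  assumes "0 < s" "s < t"
  shows "t / (exp t - 1) < s / (exp s - 1)"
proof (rule DERIV_neg_imp_decreasing[OF assms(2)])
  fix x assume "s \<le> x" "x \<le> t"
  then have x: "0 < x" using assms by simp
  have "exp x * (1 - x) < exp x * exp (- x)"
    using x exp_minus_greater[of x] by simp
  then have neg: "(exp x - 1) - x * exp x < 0"
    by (simp add: algebra_simps flip: exp_add)
  have "((\<lambda>t. t / (exp t - 1)) has_real_derivative
      ((exp x - 1) - x * exp x) / ((exp x - 1) * (exp x - 1))) (at x)"
    using x by (auto intro!: derivative_eq_intros)
  moreover have "((exp x - 1) - x * exp x) / ((exp x - 1) * (exp x - 1)) < 0"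
    using neg x by (intro divide_neg_pos mult_pos_pos) auto
  ultimately show "\<exists>y. ((\<lambda>t. t / (exp t - 1)) has_real_derivative y) (at x) \<and> y < 0"
    by blast
qed

definition log_ratio :: "real \<Rightarrow> real \<Rightarrow> real \<Rightarrow> real" where
  "log_ratio u v p = ln (1 - u powr p) + ln (1 - v powr p) - 2 * ln (1 - (u * v) powr p)"

lemma h_eq: "h u v w p = log_ratio u v p - p * ln w"
  by (simp add: h_def log_ratio_def)

lemma powr_base_less_one: "0 < a \<Longrightarrow> a < 1 \<Longrightarrow> 0 < p \<Longrightarrow> a powr p < (1::real)"
  using powr_less_mono2[of p a 1] by simp

text \<open>
  With \<open>a = u\<^sup>p\<close> and \<open>b = v\<^sup>p\<close> both \<open>1 - a\<close> and \<open>1 - b\<close> are smaller than \<open>1 - a b\<close>.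
\<close>

lemma log_ratio_neg:
  assumes "0 < u" "u < 1" "0 < v" "v < 1" "0 < p"
  shows "log_ratio u v p < 0"
proof -
  have a: "0 < u powr p" "u powr p < 1" and b: "0 < v powr p" "v powr p < 1"
    using assms by (auto intro: powr_base_less_one)
  have "u powr p * v powr p < u powr p" "u powr p * v powr p < v powr p"
    using a b by auto
  with a b have "ln (1 - u powr p) < ln (1 - u powr p * v powr p)"
    "ln (1 - v powr p) < ln (1 - u powr p * v powr p)"
    by (smt (verit) ln_less_cancel_iff)+
  with assms show ?thesis by (simp add: log_ratio_def powr_mult)
qed

text \<open>
  The derivative \<open>- a\<^sup>p ln a / (1 - a\<^sup>p)\<close> is written as \<open>\<phi>(t) / p\<close> with \<open>t = - p ln a\<close> and
  \<open>\<phi>(t) = t / (e\<^sup>t - 1)\<close>, so that its monotonicity in \<open>a\<close> can be read off.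
\<close>

lemma has_real_derivative_ln_one_minus_powr:
  fixes a p :: real
  assumes "0 < a" "a < 1" "0 < p"
  shows "((\<lambda>p. ln (1 - a powr p)) has_real_derivative
      (- ln a * p) / (exp (- ln a * p) - 1) / p) (at p)"
proof -
  have lt: "a powr p < 1" by (rule powr_base_less_one[OF assms])
  have "((\<lambda>p. ln (1 - a powr p)) has_real_derivative - (a powr p * ln a) / (1 - a powr p)) (at p)"
    using assms lt by (auto intro!: derivative_eq_intros)
  moreover have "exp (- ln a * p) = inverse (a powr p)"
    using assms by (simp add: powr_def mult.commute exp_minus)
  then have "(- ln a * p) / (exp (- ln a * p) - 1) / p = - (a powr p * ln a) / (1 - a powr p)"
    using assms lt by (simp add: field_simps)
  ultimately show ?thesis by simp
qed

text \<open>
  The product \<open>u v\<close> is smaller than both \<open>u\<close> and \<open>v\<close>, so its value of \<open>- p ln a\<close> is larger; as \<open>\<phi>\<close>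
  decreases, each of the two positive terms beats one copy of the negative one.
\<close>

lemma log_ratio_deriv_pos:
  assumes "0 < u" "u < 1" "0 < v" "v < 1" "0 < p"
  obtains D where "(log_ratio u v has_real_derivative D) (at p)" "0 < D"
proof
  let ?t = "\<lambda>a. - ln a * p"
  let ?d = "\<lambda>a. ?t a / (exp (?t a) - 1) / p"
  have uv: "0 < u * v" "u * v < 1" "u * v < u" "u * v < v"
    using assms mult_strict_mono[of u 1 v 1] by auto
  show "(log_ratio u v has_real_derivative ?d u + ?d v - 2 * ?d (u * v)) (at p)"
    unfolding log_ratio_def
    by (intro DERIV_add DERIV_diff DERIV_cmult has_real_derivative_ln_one_minus_powr assms uv)
  have "?d (u * v) < ?d a" if "0 < a" "a < 1" "u * v < a" for a
    using assms(5) that uv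
    by (intro divide_strict_right_mono inverse_exp_slope_decreasing) (auto simp: mult_neg_pos)
  from this[of u] this[of v] show "0 < ?d u + ?d v - 2 * ?d (u * v)"
    using assms uv by linarith
qed

lemma log_ratio_strict_mono:
  assumes "0 < u" "u < 1" "0 < v" "v < 1" "0 < p" "p < q"
  shows "log_ratio u v p < log_ratio u v q"
proof (rule DERIV_pos_imp_increasing[OF assms(6)])
  fix x assume "p \<le> x"
  with assms(5) have "0 < x" by simp
  then show "\<exists>D. (log_ratio u v has_real_derivative D) (at x) \<and> 0 < D"
    using log_ratio_deriv_pos[OF assms(1-4)] by metis
qed

lemma h_strict_mono:
  assumes "0 < u" "u < 1" "0 < v" "v < 1" "0 < w" "w < 1" "0 < p" "p < q"
  shows "h u v w p < h u v w q"
proof -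
  have "q * ln w < p * ln w" using assms by simp
  moreover have "log_ratio u v p < log_ratio u v q"
    using assms by (intro log_ratio_strict_mono)
  ultimately show ?thesis unfolding h_eq by linarith
qed

section \<open>The stability threshold\<close>

lemma p_star_eqI:
  assumes "0 < u" "u < 1" "0 < v" "v < 1" "0 < w" "w < 1" "0 < p" "h u v w p = 0"
  shows "p_star u v w = p"
  unfolding p_star_def
proof (rule the_equality)
  fix q assume q: "0 < q \<and> h u v w q = 0"
  show "q = p"
  proof (rule linorder_cases[of q p])
    assume "q < p"
    with h_strict_mono[of u v w q p] assms q show "q = p" by simp
  next
    assume "p < q"
    with h_strict_mono[of u v w p q] assms q show "q = p" by simp
  qed
qed (use assms in simp)

text \<open>
  A negative value of \<open>h u v w\<close> is needed at some point of \<open>(0, 1)\<close>. The choice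
  \<open>p\<^sub>0 = F(1) / ln w\<close> makes the term \<open>p\<^sub>0 ln w\<close> equal to \<open>F(1)\<close>, which exceeds \<open>F(p\<^sub>0)\<close>.
\<close>

lemma threshold_exists:
  assumes "(u, v, w) \<in> Omega"
  obtains p where "0 < p" "p < 1" "h u v w p = 0"
proof -
  have uvw: "0 < u" "u < 1" "0 < v" "v < 1" "0 < w" "w < 1" and h1: "0 < h u v w 1"
    using assms by (auto simp: Omega_def)
  define p0 where "p0 = log_ratio u v 1 / ln w"
  have w: "ln w < 0" using uvw by simp
  have "0 < p0" "p0 < 1"
    using h1 w log_ratio_neg[of u v 1] uvw
    by (auto simp: p0_def h_eq divide_neg_neg neg_divide_less_eq)
  moreover have "h u v w p0 < 0"
    using log_ratio_strict_mono[of u v p0 1] uvw w calculation by (simp add: h_eq p0_def)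
  moreover have "continuous_on {p0..1} (h u v w)"
  proof -
    have "isCont (log_ratio u v) p" if "0 < p" for p
      using log_ratio_deriv_pos[OF uvw(1-4) that] DERIV_isCont[of "log_ratio u v"] by blast
    then have "continuous_on {p0..1} (log_ratio u v)"
      using \<open>0 < p0\<close> by (intro continuous_at_imp_continuous_on) auto
    then show ?thesis
      unfolding h_eq by (intro continuous_intros)
  qed
  ultimately obtain p where "p0 \<le> p" "p \<le> 1" "h u v w p = 0"
    using IVT'[of "h u v w" p0 0 1] h1 by auto
  moreover from this have "p \<noteq> 1" using h1 by auto
  ultimately show ?thesis using \<open>0 < p0\<close> by (intro that) auto
qed

abbreviation open_cube :: "(real \<times> real \<times> real) set" where
  "open_cube \<equiv> {0<..<1} \<times> {0<..<1} \<times> {0<..<1}"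

text \<open>
  The value of \<open>w\<close> for which \<open>p\<close> is the stability threshold, that is, the solution of
  \<open>F(p) = p ln w\<close>. The exponential form makes smoothness and the derivative in \<open>p\<close> accessible.
\<close>

definition threshold_weight :: "real \<times> real \<times> real \<Rightarrow> real" where
  "threshold_weight = (\<lambda>(u, v, p). exp (log_ratio u v p / p))"

lemma Phi_eq:
  assumes "(u, v, p) \<in> open_cube"
  shows "Phi (u, v, p) = (u, v, threshold_weight (u, v, p))"
proof -
  have "0 < u * v" "u * v < 1"
    using assms mult_strict_mono[of u 1 v 1] by auto
  then have "u powr p < 1" "v powr p < 1" "(u * v) powr p < 1"
    using assms by (auto intro: powr_base_less_one)
  then have pos: "0 < 1 - u powr p" "0 < 1 - v powr p" "0 < 1 - (u * v) powr p"
    by simp_all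
  let ?X = "(1 - u powr p) * (1 - v powr p) / (1 - (u * v) powr p)\<^sup>2"
  have "ln ?X = log_ratio u v p"
    unfolding log_ratio_def using pos by (subst ln_div) (simp_all add: ln_mult ln_realpow)
  moreover have "0 < ?X"
    using pos by (intro divide_pos_pos mult_pos_pos zero_less_power)
  ultimately have "?X powr (1 / p) = exp (log_ratio u v p / p)"
    unfolding powr_def[of ?X] by (simp del: divide_eq_0_iff mult_eq_0_iff)
  then show ?thesis
    by (simp add: Phi_def threshold_weight_def)
qed

lemma threshold_weight_bounds:
  assumes "(u, v, p) \<in> open_cube"
  shows "0 < threshold_weight (u, v, p)" "threshold_weight (u, v, p) < 1"
  using assms log_ratio_neg[of u v p] by (auto simp: threshold_weight_def divide_neg_pos)

lemma h_threshold_weight: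
  assumes "(u, v, p) \<in> open_cube"
  shows "h u v (threshold_weight (u, v, p)) p = 0"
  using assms by (auto simp: h_eq threshold_weight_def)

text \<open>
  The increasing function \<open>h u v w\<close> vanishes at \<open>p < 1\<close>, so it is positive at \<open>1\<close>.
\<close>

lemma Phi_in_Omega:
  assumes "x \<in> open_cube"
  shows "Phi x \<in> Omega"
proof -
  obtain u v p where x: "x = (u, v, p)" by (cases x) auto
  with assms have m: "(u, v, p) \<in> open_cube" by simp
  let ?w = "threshold_weight (u, v, p)"
  have "h u v ?w p < h u v ?w 1"
    using m threshold_weight_bounds[OF m] by (intro h_strict_mono) auto
  then show ?thesis
    using m threshold_weight_bounds[OF m] h_threshold_weight[OF m]
    by (auto simp: x Phi_eq[OF m] Omega_def)
qed

abbreviation threshold_coords :: "real \<times> real \<times> real \<Rightarrow> real \<times> real \<times> real" where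
  "threshold_coords \<equiv> \<lambda>(u, v, w). (u, v, p_star u v w)"

lemma threshold_coords_Phi:
  assumes "x \<in> open_cube"
  shows "threshold_coords (Phi x) = x"
proof -
  obtain u v p where x: "x = (u, v, p)" by (cases x) auto
  with assms have m: "(u, v, p) \<in> open_cube" by simp
  then show ?thesis
    using p_star_eqI[OF _ _ _ _ threshold_weight_bounds[OF m] _ h_threshold_weight[OF m]]
    by (auto simp: x Phi_eq[OF m])
qed

lemma Phi_threshold_coords:
  assumes "y \<in> Omega"
  shows "threshold_coords y \<in> open_cube" "Phi (threshold_coords y) = y"
proof -
  obtain u v w where y: "y = (u, v, w)" by (cases y) auto
  with assms have m: "(u, v, w) \<in> Omega" by simp
  then have uvw: "0 < u" "u < 1" "0 < v" "v < 1" "0 < w" "w < 1"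
    by (auto simp: Omega_def)
  obtain p where p: "0 < p" "p < 1" "h u v w p = 0"
    using threshold_exists[OF m] .
  then have ps: "p_star u v w = p" using p_star_eqI uvw by blast
  show cube: "threshold_coords y \<in> open_cube"
    using uvw p ps by (simp add: y)
  have "log_ratio u v p / p = ln w" using p by (simp add: h_eq field_simps)
  then have "threshold_weight (u, v, p) = w"
    using uvw by (simp add: threshold_weight_def)
  then show "Phi (threshold_coords y) = y"
    using cube Phi_eq[of u v p] by (simp add: y ps)
qed

lemma Phi_image: "Phi ` open_cube = Omega"
proof
  show "Omega \<subseteq> Phi ` open_cube"
  proof
    show "y \<in> Phi ` open_cube" if "y \<in> Omega" for y
      by (rule image_eqI[where x = "threshold_coords y"])
         (rule Phi_threshold_coords(2)[OF that, symmetric], rule Phi_threshold_coords(1)[OF that])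
  qed
qed (use Phi_in_Omega in blast)

lemma threshold_coords_image: "threshold_coords ` Omega = open_cube"
proof
  show "open_cube \<subseteq> threshold_coords ` Omega"
  proof
    show "x \<in> threshold_coords ` Omega" if "x \<in> open_cube" for x
      by (rule image_eqI[where x = "Phi x"])
         (rule threshold_coords_Phi[OF that, symmetric], rule Phi_in_Omega[OF that])
  qed
qed (use Phi_threshold_coords(1) in blast)

section \<open>Smoothness\<close>

lemma open_open_cube: "open open_cube"
  by (intro open_Times open_greaterThanLessThan)

lemma smooth_on_proj [smooth_intros]:
  assumes "open (S :: (real \<times> real \<times> real) set)"
  shows "smooth_on S fst" "smooth_on S (\<lambda>x. fst (snd x))" "smooth_on S (\<lambda>x. snd (snd x))"
  by (auto intro!: smooth_on_linear assms bounded_linear_fst bounded_linear_snd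
      bounded_linear_fst_comp bounded_linear_snd_comp)

lemma smooth_on_threshold_weight: "smooth_on open_cube threshold_weight"
proof -
  let ?pow = "\<lambda>a p. exp (p * ln a) :: real"
  have less: "?pow a p < 1" if "0 < a" "a < 1" "0 < p" for a p
    using powr_base_less_one[OF that] that by (simp add: powr_def)
  have mul: "0 < u * v \<and> u * v < 1" if "0 < u" "u < 1" "0 < v" "v < 1" for u v :: real
    using that mult_strict_mono[of u 1 v 1] by auto
  have "smooth_on open_cube (\<lambda>x. exp ((ln (1 - ?pow (fst x) (snd (snd x)))
      + ln (1 - ?pow (fst (snd x)) (snd (snd x)))
      - 2 * ln (1 - ?pow (fst x * fst (snd x)) (snd (snd x)))) / snd (snd x)))"
    by (intro smooth_intros open_open_cube) (auto simp: less mul mult_pos_neg)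
  then show ?thesis
    by (rule smooth_on_cong[OF _ open_open_cube])
       (auto simp: threshold_weight_def log_ratio_def powr_def)
qed

lemma smooth_on_Phi: "smooth_on open_cube Phi"
proof -
  have "smooth_on open_cube (\<lambda>x. (fst x, fst (snd x), threshold_weight x))"
    by (intro smooth_intros open_open_cube smooth_on_threshold_weight)
  then show ?thesis
    by (rule smooth_on_cong[OF _ open_open_cube]) (auto simp: Phi_eq)
qed

text \<open>
  The derivative of \<open>F(p) / p\<close> is \<open>(p F'(p) - F(p)) / p\<^sup>2\<close>, and both \<open>F'(p)\<close> and \<open>- F(p)\<close> are positive.
\<close>

lemma threshold_weight_partial_p:
  assumes "x \<in> open_cube"
  shows "frechet_derivative threshold_weight (at x) (0, 0, 1) > 0"
proof -
  obtain u v p where x: "x = (u, v, p)" by (cases x) auto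
  with assms have uvp: "0 < u" "u < 1" "0 < v" "v < 1" "0 < p" by auto
  obtain D where D: "(log_ratio u v has_real_derivative D) (at p)" "0 < D"
    using log_ratio_deriv_pos[OF uvp] .
  let ?E = "exp (log_ratio u v p / p) * ((D * p - log_ratio u v p) / (p * p))"
  have "((\<lambda>q. threshold_weight (u, v, q)) has_real_derivative ?E) (at p)"
    unfolding threshold_weight_def prod.case
    using DERIV_fun_exp[OF DERIV_divide[OF D(1) DERIV_ident]] uvp by simp
  moreover have "((\<lambda>q. threshold_weight (u, v, q)) has_derivative
      (\<lambda>t. frechet_derivative threshold_weight (at x) (0, 0, t))) (at p)"
  proof (rule has_derivative_compose[where f = "\<lambda>q. (u, v, q)"])
    show "((\<lambda>q. (u, v, q)) has_derivative (\<lambda>t. (0, 0, t))) (at p)"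
      by (auto intro!: derivative_eq_intros)
    show "(threshold_weight has_derivative frechet_derivative threshold_weight (at x)) (at (u, v, p))"
      using smooth_on_has_derivative[OF smooth_on_threshold_weight assms] by (simp add: x)
  qed
  ultimately have "(\<lambda>t. frechet_derivative threshold_weight (at x) (0, 0, t)) = (*) ?E"
    unfolding has_field_derivative_def by (intro has_derivative_unique)
  then have "frechet_derivative threshold_weight (at x) (0, 0, 1) = ?E"
    by (auto dest: fun_cong[where x = 1])
  moreover have "0 < D * p - log_ratio u v p"
    using log_ratio_neg[OF uvp] mult_pos_pos[OF D(2) uvp(5)] by linarith
  ultimately show ?thesis using uvp by simp
qed

text \<open>
  The differential of \<^const>\<open>Phi\<close> sends \<open>(a, b, t)\<close> to \<open>(a, b, D (a, b, t))\<close>, where \<open>D\<close> is the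
  differential of the last component. Solving \<open>D (a, b, t) = c\<close> for \<open>t\<close> divides by the partial
  derivative in \<open>p\<close> only, so the inverse is explicit and smooth in the base point.
\<close>

lemma smooth_on_threshold_coords: "open Omega" "smooth_on Omega threshold_coords"
proof -
  let ?D = "\<lambda>x. frechet_derivative threshold_weight (at x)"
  let ?B = "\<lambda>x (a, b, c). (a, b, (c - ?D x (a, b, 0)) / ?D x (0, 0, 1))"
  have right_inv: "frechet_derivative Phi (at x) \<circ> ?B x = id" if x: "x \<in> open_cube" for x
  proof -
    have D: "(threshold_weight has_derivative ?D x) (at x)"
      using smooth_on_has_derivative[OF smooth_on_threshold_weight x] .
    have "((\<lambda>x. (fst x, fst (snd x), threshold_weight x)) has_derivative
        (\<lambda>y. (fst y, fst (snd y), ?D x y))) (at x)"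
      by (intro derivative_intros D)
    then have "(Phi has_derivative (\<lambda>y. (fst y, fst (snd y), ?D x y))) (at x)"
      by (rule has_derivative_transform_within_open[OF _ open_open_cube x]) (auto simp: Phi_eq)
    then have fre: "frechet_derivative Phi (at x) = (\<lambda>y. (fst y, fst (snd y), ?D x y))"
      by (rule frechet_derivative_at[symmetric])
    have lin: "linear (?D x)" using D has_derivative_linear by blast
    have split: "?D x (a, b, t) = ?D x (a, b, 0) + t * ?D x (0, 0, 1)" for a b t
      using linear_add[OF lin, of "(a, b, 0)" "t *\<^sub>R (0, 0, 1)"] linear_cmul[OF lin, of t "(0, 0, 1)"]
      by simp
    have "?D x (a, b, (c - ?D x (a, b, 0)) / ?D x (0, 0, 1)) = c" for a b c
      using threshold_weight_partial_p[OF x]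
      by (subst split[of a b "(c - ?D x (a, b, 0)) / ?D x (0, 0, 1)"]) simp
    then show ?thesis by (auto simp: fre fun_eq_iff)
  qed
  have smooth_B: "smooth_on open_cube (\<lambda>x. ?B x y)" for y
  proof -
    obtain a b c where y: "y = (a, b, c)" by (cases y) auto
    have "smooth_on open_cube (\<lambda>x. (a, b, (c - ?D x (a, b, 0)) / ?D x (0, 0, 1)))"
      by (intro smooth_intros open_open_cube
          smooth_on_frechet_derivative[OF smooth_on_threshold_weight])
         (use threshold_weight_partial_p in force)
    then show ?thesis by (simp add: y)
  qed
  show "open Omega" "smooth_on Omega threshold_coords"
    using smooth_on_left_inverse[OF open_open_cube smooth_on_Phi threshold_coords_Phi right_inv smooth_B]
    unfolding Phi_image by auto
qed

lemma smooth_diffeomorphism_sym: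
  "smooth_diffeomorphism S T f g \<Longrightarrow> smooth_diffeomorphism T S g f"
  by (simp add: smooth_diffeomorphism_def)

theorem theorem3p2:
  shows "Phi \<in> ({0<..<1} \<times> {0<..<1} \<times> {0<..<1}) \<rightarrow> Omega
    \<and> smooth_diffeomorphism ({0<..<1} \<times> {0<..<1} \<times> {0<..<1}) Omega Phi (\<lambda>(u, v, w). (u, v, p_star u v w))
    \<and> global_smooth_coordinates Omega (\<lambda>(u, v, w). (u, v, p_star u v w))"
proof -
  have "smooth_diffeomorphism open_cube Omega Phi threshold_coords"
    unfolding smooth_diffeomorphism_def
    by (intro conjI ballI open_open_cube smooth_on_threshold_coords smooth_on_Phi
      Phi_image threshold_coords_image threshold_coords_Phi Phi_threshold_coords(2))
  moreover from this have "global_smooth_coordinates Omega threshold_coords"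
    unfolding global_smooth_coordinates_def
    by (intro exI) (rule smooth_diffeomorphism_sym)
  ultimately show ?thesis by (intro conjI Pi_I Phi_in_Omega)
qed

end
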